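(* Let $\varphi$ be a random variable with probability distribution supported in $[0,1)$ (that is, $\varphi\in[0,1)$ almost surely), and let $u_k=\mathbb{E}[\varphi^k]$ for $k\ge 1$. Let $\Phi(z)=1-a(z)$ for $z\in\overline{D(0,1)}=\{z\in\mathbb{C}:|z|\le 1\}$, where $a$ is the continuous function on $\overline{D(0,1)}$ extending $z\mapsto \frac{m(z)}{1+m(z)}$, with $m(z)=\sum_{k\ge 1}u_kz^k$. Then $z=1$ is a zero of $\Phi$ if and only if $\sum_{k=1}^{\infty}u_k=+\infty$.
   Context: The power series $m$ converges for $|z|<1$, and on $|z|=1$, $z\ne 1$, it converges as a limit of partial sums, so $m$ is defined on $\overline{D(0,1)}\setminus\{1\}$. It is known that $1+m$ does not vanish there and that $\frac{m}{1+m}$ extends (uniquely) to a continuous function $a$ on $\overline{D(0,1)}$. In $D(0,1)=\{|z|<1\}$ one has $a(z)=\sum_{k\ge 1}a_kz^k$, where $a_1=u_1$ and $a_{k+1}=u_{k+1}-\sum_{r=1}^{k}a_ru_{k-r+1}$ for $k\ge1$; moreover the series $\sum_{k\ge 1} a_k$ converges and $a(1)=\sum_{k\ge1}a_k=\lim_{r\to1^-}a(r)$. *)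

theory Defs
  imports "HOL-Probability.Probability"
begin

definition moment :: "'a measure \<Rightarrow> ('a \<Rightarrow> real) \<Rightarrow> nat \<Rightarrow> real" where
  "moment M \<phi> k = (\<integral>x. \<phi> x ^ k \<partial>M)"

(* The sum starts at index 1. "suminf" is the limit of the partial sums, so on the unit circle,
   where absolute convergence may fail, it denotes the conditionally convergent sum. *)
definition gen_fun :: "(nat \<Rightarrow> real) \<Rightarrow> complex \<Rightarrow> complex" where
  "gen_fun u z = (\<Sum>k. complex_of_real (u (Suc k)) * z ^ Suc k)"

(* These conditions determine a on the closed unit disc, because 1 is a limit point of the
   rest of the disc; the values of a outside the disc are irrelevant. *)
definition continuous_ext :: "(complex \<Rightarrow> complex) \<Rightarrow> (complex \<Rightarrow> complex) \<Rightarrow> bool" where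
  "continuous_ext m a \<longleftrightarrow>
     continuous_on (cball 0 1) a \<and> (\<forall>z\<in>cball 0 1 - {1}. a z = m z / (1 + m z))"

end

theory Submission
  imports Defs
begin

text \<open>
  For real \<open>r\<close> in \<open>[0,1)\<close> one has \<open>1 - a r = 1 / (1 + m r)\<close>, and continuity of \<open>a\<close> turns
  \<open>\<Phi> 1 = 0\<close> into \<open>m r \<rightarrow> \<infinity>\<close> as \<open>r\<close> tends to 1 from the left. As the coefficients of \<open>m\<close>
  are nonnegative, this is equivalent to the divergence of their sum.
\<close>

text \<open>The only input from probability: powers of \<open>\<phi>\<close> lie in
  \<open>[0,1]\<close> almost surely, and the mean inherits both bounds.\<close>

lemma (in prob_space) moment_bounds:
  assumes "\<phi> \<in> borel_measurable M" and "AE x in M. \<phi> x \<in> {0..<1}"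
  shows "0 \<le> moment M \<phi> k" and "moment M \<phi> k \<le> 1"
proof -
  have *: "AE x in M. 0 \<le> \<phi> x ^ k \<and> \<phi> x ^ k \<le> 1"
    using assms(2) by eventually_elim (auto intro: power_le_one)
  show "0 \<le> moment M \<phi> k"
    unfolding moment_def using * by (intro integral_nonneg_AE) auto
  have "integrable M (\<lambda>x. \<phi> x ^ k)"
    using * assms(1) by (intro integrable_const_bound[where B = 1]) auto
  then show "moment M \<phi> k \<le> 1"
    unfolding moment_def using * by (intro integral_le_const) auto
qed

lemma summable_bounded_coeffs:
  fixes c :: "nat \<Rightarrow> real"
  assumes "\<And>k. 0 \<le> c k" and "\<And>k. c k \<le> B" and "0 \<le> r" and "r < 1"
  shows "summable (\<lambda>k. c k * r ^ Suc k)"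
proof (rule summable_comparison_test')
  show "summable (\<lambda>k. B * (r * r ^ k))"
    using assms(3,4) by (intro summable_mult summable_geometric) auto
  show "norm (c k * r ^ Suc k) \<le> B * (r * r ^ k)" if "k \<ge> 0" for k
    using assms by (auto simp: abs_mult intro!: mult_right_mono)
qed

text \<open>Both directions pass through a finite partial sum. Nonnegative terms make a truncation a
  lower bound for the series, and each truncation is continuous in \<open>r\<close> up to 1.\<close>

lemma power_series_at_top_iff:
  fixes c :: "nat \<Rightarrow> real"
  assumes nonneg: "\<And>k. 0 \<le> c k" and bounded: "\<And>k. c k \<le> B"
  shows "filterlim (\<lambda>r. \<Sum>k. c k * r ^ Suc k) at_top (at_left 1)
    \<longleftrightarrow> filterlim (\<lambda>n. \<Sum>k<n. c k) at_top sequentially"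
    (is "filterlim ?F _ _ \<longleftrightarrow> filterlim ?S _ _")
proof
  have unit: "\<forall>\<^sub>F r in at_left 1. 0 < r \<and> r < (1::real)"
    using eventually_at_left_real[of 0 1] by simp
  note summ = summable_bounded_coeffs[OF nonneg bounded]
  show "filterlim ?S at_top sequentially" if F: "filterlim ?F at_top (at_left 1)"
    unfolding filterlim_at_top
  proof
    fix Z
    have "\<forall>\<^sub>F r in at_left 1. Z < ?F r"
      using F by (simp add: filterlim_at_top_dense)
    with unit have "\<forall>\<^sub>F r in at_left 1. 0 < r \<and> r < 1 \<and> Z < ?F r"
      by eventually_elim auto
    then obtain r where r: "0 < r" "r < 1" "Z < ?F r"
      using eventually_happens'[OF trivial_limit_at_left_real] by blast
    \<comment> \<open>With \<open>r\<close> fixed first, long partial sums at \<open>r\<close>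
      already exceed \<open>Z\<close>; replacing each power of \<open>r\<close> by 1 can only
      enlarge them.\<close>
    have "(\<lambda>n. \<Sum>k<n. c k * r ^ Suc k) \<longlonglongrightarrow> ?F r"
      using summ[of r] r by (intro summable_LIMSEQ) auto
    then have "\<forall>\<^sub>F n in sequentially. Z < (\<Sum>k<n. c k * r ^ Suc k)"
      using r(3) by (rule order_tendstoD)
    then show "\<forall>\<^sub>F n in sequentially. Z \<le> ?S n"
    proof eventually_elim
      case (elim n)
      have "r ^ Suc k \<le> 1" for k
        using r by (intro power_le_one) auto
      then have "(\<Sum>k<n. c k * r ^ Suc k) \<le> ?S n"
        using nonneg by (intro sum_mono mult_right_le_one_le) (use r in auto)
      with elim show ?case by linarith
    qed
  qed
  show "filterlim ?F at_top (at_left 1)" if S: "filterlim ?S at_top sequentially"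
    unfolding filterlim_at_top
  proof
    fix Z
    have "\<forall>\<^sub>F n in sequentially. Z < ?S n"
      using S by (simp add: filterlim_at_top_dense)
    then obtain n where n: "Z < ?S n"
      using eventually_happens' sequentially_bot by blast
    \<comment> \<open>Here \<open>n\<close> is fixed first and \<open>r\<close> then moves to 1, so
      only the continuity of a polynomial is needed.\<close>
    have "((\<lambda>r. \<Sum>k<n. c k * r ^ Suc k) \<longlongrightarrow> (\<Sum>k<n. c k * 1 ^ Suc k)) (at_left 1)"
      by (intro tendsto_intros)
    then have "\<forall>\<^sub>F r in at_left 1. Z < (\<Sum>k<n. c k * r ^ Suc k)"
      using n by (intro order_tendstoD) auto
    with unit show "\<forall>\<^sub>F r in at_left 1. Z \<le> ?F r"
    proof eventually_elim
      case (elim r)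
      have "(\<Sum>k<n. c k * r ^ Suc k) \<le> ?F r"
        using elim nonneg by (intro sum_le_suminf summ) auto
      with elim show ?case by linarith
    qed
  qed
qed

theorem corollary1:
  fixes M :: "'a measure" and \<phi> :: "'a \<Rightarrow> real"
    and u :: "nat \<Rightarrow> real" and a \<Phi> :: "complex \<Rightarrow> complex"
  assumes "prob_space M"
    and "\<phi> \<in> borel_measurable M"
    and "AE x in M. \<phi> x \<in> {0..<1}"
    and "\<And>k. k \<ge> 1 \<Longrightarrow> u k = moment M \<phi> k"
    and "continuous_ext (gen_fun u) a"
    and "\<And>z. z \<in> cball 0 1 \<Longrightarrow> \<Phi> z = 1 - a z"
  shows "\<Phi> 1 = 0 \<longleftrightarrow> filterlim (\<lambda>n. \<Sum>k=1..n. u k) at_top sequentially"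
proof -
  define F where "F r = (\<Sum>k. u (Suc k) * r ^ Suc k)" for r :: real
  have u: "0 \<le> u (Suc k)" "u (Suc k) \<le> 1" for k
    using prob_space.moment_bounds[OF assms(1-3)] assms(4) by auto
  have unit: "\<forall>\<^sub>F r in at_left 1. 0 < r \<and> r < (1::real)"
    using eventually_at_left_real[of 0 1] by simp
  note summ = summable_bounded_coeffs[OF u]
  have F_nonneg: "0 \<le> F r" if "0 < r" "r < 1" for r
    unfolding F_def using that u by (intro suminf_nonneg summ) auto
  have \<Phi>_eq: "\<Phi> (of_real r) = of_real (inverse (1 + F r))" if r: "0 < r" "r < 1" for r
  proof -
    \<comment> \<open>At a real point below 1 the complex series is the embedded real one, and the
      point differs from 1, so the quotient formula for \<open>a\<close> applies there.\<close>
    have "gen_fun u (of_real r) = of_real (F r)"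
      unfolding gen_fun_def F_def using suminf_of_real[OF summ[of r], where ?'a = complex] r
      by simp
    then have "\<Phi> (of_real r) = of_real (1 - F r / (1 + F r))"
      using assms(5,6) r by (simp add: continuous_ext_def)
    also have "1 - F r / (1 + F r) = inverse (1 + F r)"
      using F_nonneg[OF r] by (simp add: field_simps)
    finally show ?thesis .
  qed
  have "continuous_on (cball 0 1) \<Phi>"
    using assms(5,6) unfolding continuous_ext_def
    by (subst continuous_on_cong[OF refl assms(6)]) (auto intro: continuous_intros)
  then have "continuous_on {0..1} (\<lambda>r. \<Phi> (of_real r))"
    by (rule continuous_on_compose2) (auto intro: continuous_intros)
  then have "((\<lambda>r. \<Phi> (of_real r)) \<longlongrightarrow> \<Phi> (of_real 1)) (at_left 1)"
    using continuous_on_Icc_at_leftD[of 0 1 "\<lambda>r. \<Phi> (of_real r)"] by simp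
  moreover have "\<forall>\<^sub>F r in at_left 1. \<Phi> (of_real r) = of_real (inverse (1 + F r))"
    using unit by eventually_elim (auto simp: \<Phi>_eq)
  ultimately have lim: "((\<lambda>r. complex_of_real (inverse (1 + F r))) \<longlongrightarrow> \<Phi> 1) (at_left 1)"
    by (simp add: tendsto_cong)
  \<comment> \<open>The limit is known to be \<open>\<Phi> 1\<close>; uniqueness of limits gives the
    converse implication. Writing 0 as \<open>of_real 0\<close> allows the descent to real
    limits.\<close>
  have "\<Phi> 1 = 0 \<longleftrightarrow> ((\<lambda>r. complex_of_real (inverse (1 + F r))) \<longlongrightarrow> of_real 0) (at_left 1)"
    using lim tendsto_unique[OF trivial_limit_at_left_real lim] by (metis of_real_0)
  also have "\<dots> \<longleftrightarrow> ((\<lambda>r. inverse (1 + F r)) \<longlongrightarrow> 0) (at_left 1)"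
    by (rule tendsto_of_real_iff)
  also have "\<dots> \<longleftrightarrow> filterlim (\<lambda>r. 1 + F r) at_top (at_left 1)"
  proof -
    \<comment> \<open>Positivity matters: a function tending to 0 has a reciprocal tending to plus
      infinity only if it is eventually positive.\<close>
    have "\<forall>\<^sub>F r in at_left 1. 0 < inverse (1 + F r)"
      using unit by eventually_elim (use F_nonneg in force)
    from filterlim_inverse_at_top_iff[OF this] show ?thesis
      by simp
  qed
  also have "\<dots> \<longleftrightarrow> filterlim F at_top (at_left 1)"
    \<comment> \<open>Adding the constant 1 gives one direction, adding -1 the other.\<close>
    using filterlim_tendsto_add_at_top[OF tendsto_const[of "1::real"], of F "at_left 1"]
      filterlim_tendsto_add_at_top[OF tendsto_const[of "-1::real"], of "\<lambda>r. 1 + F r" "at_left 1"]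
    by auto
  also have "\<dots> \<longleftrightarrow> filterlim (\<lambda>n. \<Sum>k<n. u (Suc k)) at_top sequentially"
    unfolding F_def using u by (rule power_series_at_top_iff)
  also have "(\<lambda>n. \<Sum>k<n. u (Suc k)) = (\<lambda>n. \<Sum>k=1..n. u k)"
    by (simp add: sum.atLeast1_atMost_eq)
  finally show ?thesis .
qed

end
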